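(* Let $(\Omega,\mathscr B)$ be a standard Borel space and $\mathscr C$ a concept class of Borel subsets of $\Omega$ (no further measurability assumption on the class). If $\mathscr C$ is PAC learnable under the family of all non-atomic Borel probability measures on $\Omega$, then $\mathrm{VC}(\mathscr C\,\mathrm{mod}\,\omega_1)<\infty$.
   Context: $\mathrm{VC}(\mathscr C\,\mathrm{mod}\,\omega_1)$ is the supremum of $n$ for which there exist uncountable sets $A_1,\dots,A_n\subseteq\Omega$ such that for every $J\subseteq\{1,\dots,n\}$ some $C\in\mathscr C$ contains $A_i$ for all $i\in J$ and is disjoint from $A_j$ for all $j\notin J$. A learning rule for $\mathscr C$ under a family $\mathcal P$ of probability measures is a map $\mathcal L:\bigcup_n\Omega^n\times\{0,1\}^n\to\mathscr C$ such that $\sigma\mapsto\mu(\mathcal L(\sigma,C\cap\sigma)\triangle C)$ is $\mu^{\otimes n}$-measurable for all $C\in\mathscr C,\mu\in\mathcal P,n$; it is PAC under $\mathcal P$ if for every $\varepsilon>0$, $\sup_{\mu\in\mathcal P}\sup_{C\in\mathscr C}\mu^{\otimes n}\{\sigma:\mu(\mathcal L(\sigma,C\cap\sigma)\triangle C)>\varepsilon\}\to0$ as $n\to\infty$; $\mathscr C$ is PAC learnable under $\mathcal P$ if a PAC rule exists. A measure is non-atomic if every set of positive measure contains a subset of strictly smaller positive measure. *)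

theory Defs
  imports "HOL-Probability.Probability"
begin

definition Polish_space :: "'a topology \<Rightarrow> bool" where
  "Polish_space X \<longleftrightarrow> completely_metrizable_space X \<and> separable_space X"

definition standard_borel :: "'a measure \<Rightarrow> bool" where
  "standard_borel M \<longleftrightarrow>
     (\<exists>X :: 'a topology. Polish_space X \<and> topspace X = space M \<and>
        sets M = sigma_sets (topspace X) {U. openin X U})"

definition nonatomic :: "'a measure \<Rightarrow> bool" where
  "nonatomic \<mu> \<longleftrightarrow> (\<forall>A\<in>sets \<mu>. measure \<mu> A > 0 \<longrightarrow>
      (\<exists>B\<in>sets \<mu>. B \<subseteq> A \<and> 0 < measure \<mu> B \<and> measure \<mu> B < measure \<mu> A))"

definition nonatomic_probs :: "'a measure \<Rightarrow> 'a measure set" where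
  "nonatomic_probs M = {\<mu>. sets \<mu> = sets M \<and> prob_space \<mu> \<and> nonatomic \<mu>}"

definition prodn :: "nat \<Rightarrow> 'a measure \<Rightarrow> (nat \<Rightarrow> 'a) measure" where
  "prodn n \<mu> = PiM {..<n} (\<lambda>_. \<mu>)"

definition labelled :: "nat \<Rightarrow> (nat \<Rightarrow> 'a) \<Rightarrow> 'a set \<Rightarrow> ('a \<times> bool) list" where
  "labelled n \<sigma> C = map (\<lambda>i. (\<sigma> i, \<sigma> i \<in> C)) [0..<n]"

definition err :: "(('a \<times> bool) list \<Rightarrow> 'a set) \<Rightarrow> 'a measure \<Rightarrow> 'a set \<Rightarrow> nat \<Rightarrow> (nat \<Rightarrow> 'a) \<Rightarrow> real" where
  "err L \<mu> C n \<sigma> = measure \<mu> (sym_diff (L (labelled n \<sigma> C)) C)"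

definition learning_rule ::
  "'a set set \<Rightarrow> 'a measure set \<Rightarrow> (('a \<times> bool) list \<Rightarrow> 'a set) \<Rightarrow> bool" where
  "learning_rule \<C> P L \<longleftrightarrow> (\<forall>s. L s \<in> \<C>) \<and>
     (\<forall>C\<in>\<C>. \<forall>\<mu>\<in>P. \<forall>n. err L \<mu> C n \<in> borel_measurable (completion (prodn n \<mu>)))"

definition PAC_rule ::
  "'a set set \<Rightarrow> 'a measure set \<Rightarrow> (('a \<times> bool) list \<Rightarrow> 'a set) \<Rightarrow> bool" where
  "PAC_rule \<C> P L \<longleftrightarrow> learning_rule \<C> P L \<and>
     (\<forall>\<epsilon>>0. (\<lambda>n. SUP \<mu>\<in>P. SUP C\<in>\<C>.
         emeasure (completion (prodn n \<mu>))
           {\<sigma> \<in> space (prodn n \<mu>). err L \<mu> C n \<sigma> > \<epsilon>}) \<longlonglongrightarrow> 0)"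

definition PAC_learnable :: "'a set set \<Rightarrow> 'a measure set \<Rightarrow> bool" where
  "PAC_learnable \<C> P \<longleftrightarrow> (\<exists>L. PAC_rule \<C> P L)"

definition shatters_mod_omega1 :: "'a set \<Rightarrow> 'a set set \<Rightarrow> nat \<Rightarrow> bool" where
  "shatters_mod_omega1 \<Omega> \<C> n \<longleftrightarrow>
     (\<exists>A :: nat \<Rightarrow> 'a set. (\<forall>i<n. A i \<subseteq> \<Omega> \<and> uncountable (A i)) \<and>
        (\<forall>J\<subseteq>{..<n}. \<exists>C\<in>\<C>. (\<forall>i\<in>J. A i \<subseteq> C) \<and> (\<forall>j\<in>{..<n} - J. C \<inter> A j = {})))"

definition VC_mod_omega1 :: "'a set \<Rightarrow> 'a set set \<Rightarrow> enat" where
  "VC_mod_omega1 \<Omega> \<C> = Sup {enat n | n. shatters_mod_omega1 \<Omega> \<C> n}"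

end

theory Submission
  imports Defs
begin

text \<open>
  If \<open>N\<close> uncountable sets are shattered, then they can be enlarged to pairwise disjoint Borel sets
  \<open>B\<^sub>i\<close>, namely the atoms of the finite algebra generated by the shattering concepts, which are
  still shattered by the same concepts. By the perfect set theorem, each \<open>B\<^sub>i\<close> contains a Borel
  injective image of a unit interval, so some non-atomic probability measure gives mass \<open>1/N\<close> to
  each \<open>B\<^sub>i\<close>. A sample of size \<open>m \<le> N/2\<close> misses at least half of the blocks, and for a block that
  was missed the two possible labels are indistinguishable; hence the error averaged over all
  shattering concepts is at least \<open>1/4\<close>, which contradicts learnability.

  The perfect set theorem is obtained from the fact that a Borel set is the projection of a
  closed subset of the product with the Baire space, by a binary splitting scheme.
\<close>

section \<open>Borel sets as projections of closed sets\<close>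

context Metric_space
begin

text \<open>
  The cells \<open>cell n p\<close> form a neighbourhood base at \<open>p\<close> in the product of the metric space with the
  Baire space, so \<open>cell_closed\<close> is closedness in that product.
\<close>
definition cell :: "nat \<Rightarrow> 'a \<times> (nat \<Rightarrow> nat) \<Rightarrow> ('a \<times> (nat \<Rightarrow> nat)) set" where
  "cell n p = {q. fst q \<in> mball (fst p) (inverse (Suc n)) \<and> (\<forall>i<n. snd q i = snd p i)}"

definition cell_closed :: "('a \<times> (nat \<Rightarrow> nat)) set \<Rightarrow> bool" where
  "cell_closed R \<longleftrightarrow> R \<subseteq> M \<times> UNIV \<and>
     (\<forall>p\<in>M \<times> UNIV. (\<forall>n. cell n p \<inter> R \<noteq> {}) \<longrightarrow> p \<in> R)"

definition analytic_set :: "'a set \<Rightarrow> bool" where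
  "analytic_set B \<longleftrightarrow> (\<exists>R. cell_closed R \<and> B = fst ` R)"

lemma cell_antimono: "m \<le> n \<Longrightarrow> cell n p \<subseteq> cell m p"
proof -
  assume "m \<le> n"
  then have "inverse (real (Suc n)) \<le> inverse (real (Suc m))"
    by (intro le_imp_inverse_le) auto
  with \<open>m \<le> n\<close> show ?thesis
    by (auto simp: cell_def simp del: of_nat_Suc intro: less_le_trans)
qed

lemma cell_closed_subset: "cell_closed R \<Longrightarrow> R \<subseteq> M \<times> UNIV"
  by (simp add: cell_closed_def)

lemma cell_closedD:
  assumes "cell_closed R" "fst p \<in> M" "\<And>n. \<exists>q\<in>R. q \<in> cell n p"
  shows "p \<in> R"
  using assms unfolding cell_closed_def by (cases p) (auto, blast)

lemma cell_closedI:
  assumes "R \<subseteq> M \<times> UNIV"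
    "\<And>x y. x \<in> M \<Longrightarrow> (\<And>n. \<exists>q\<in>R. q \<in> cell n (x, y)) \<Longrightarrow> (x, y) \<in> R"
  shows "cell_closed R"
  unfolding cell_closed_def
proof (intro conjI ballI impI)
  fix p :: "'a \<times> (nat \<Rightarrow> nat)"
  assume "p \<in> M \<times> UNIV" "\<forall>n. cell n p \<inter> R \<noteq> {}"
  then show "p \<in> R" using assms(2)[of "fst p" "snd p"] by (cases p) fastforce
qed (rule assms(1))

text \<open>A closed set is analytic with an unrestricted second coordinate. An open set is the
  union over n of the closed sets of points whose ball of radius 1/(n+1) stays inside it. Both
  halves feed the induction over Borel sets, which treats a set together with its
  complement.\<close>

lemma analytic_set_openin:
  assumes U: "openin mtopology U"
  shows "analytic_set (M - U)"
    and "\<exists>F :: nat \<Rightarrow> 'a set. (\<forall>n. analytic_set (F n)) \<and> U = (\<Union>n. F n)"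
proof -
  have small: "\<exists>n. inverse (real (Suc n)) < r" if "r > 0" for r
    using reals_Archimedean[OF that] .
  have UM: "U \<subseteq> M" and Uball: "\<And>x. x \<in> U \<Longrightarrow> \<exists>r>0. mball x r \<subseteq> U"
    using U by (auto simp: openin_mtopology)
  have "cell_closed ((M - U) \<times> UNIV)"
  proof (rule cell_closedI)
    fix x :: 'a and y :: "nat \<Rightarrow> nat"
    assume x: "x \<in> M" and lim: "\<And>n. \<exists>q\<in>(M - U) \<times> UNIV. q \<in> cell n (x, y)"
    have "x \<notin> U"
    proof
      assume "x \<in> U"
      then obtain r where "r > 0" "mball x r \<subseteq> U" using Uball by blast
      moreover obtain n where "inverse (real (Suc n)) < r"
        using small[OF \<open>r > 0\<close>] by blast
      moreover obtain q where "q \<in> (M - U) \<times> UNIV" "q \<in> cell n (x, y)" using lim by blast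
      ultimately show False by (fastforce simp: cell_def simp del: of_nat_Suc)
    qed
    then show "(x, y) \<in> (M - U) \<times> UNIV" using x by simp
  qed auto
  then show "analytic_set (M - U)"
    unfolding analytic_set_def by (intro exI[of _ "(M - U) \<times> UNIV"]) auto
  define F where "F n = {x \<in> M. mball x (inverse (Suc n)) \<subseteq> U}" for n :: nat
  have "cell_closed (F k \<times> UNIV)" for k
  proof (rule cell_closedI)
    fix x :: 'a and y :: "nat \<Rightarrow> nat"
    assume x: "x \<in> M" and lim: "\<And>n. \<exists>q\<in>F k \<times> UNIV. q \<in> cell n (x, y)"
    have "z \<in> U" if z: "z \<in> mball x (inverse (Suc k))" for z
    proof -
      \<comment> \<open>Since \<open>z\<close> lies strictly inside the ball about \<open>x\<close>,
        it stays inside when the centre moves to a close enough point of \<open>F k\<close>.\<close>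
      have "inverse (real (Suc k)) - d x z > 0" using z by simp
      then obtain n where n: "inverse (real (Suc n)) < inverse (real (Suc k)) - d x z"
        using small by blast
      obtain q where q: "q \<in> F k \<times> UNIV" "q \<in> cell n (x, y)" using lim by blast
      have "z \<in> mball (fst q) (inverse (Suc k))"
        using q n z x triangle[of "fst q" x z]
        by (auto simp: cell_def F_def commute[of x] simp del: of_nat_Suc)
      with q show ?thesis by (auto simp: F_def)
    qed
    then show "(x, y) \<in> F k \<times> UNIV" using x by (auto simp: F_def)
  qed (auto simp: F_def)
  then have "analytic_set (F k)" for k
    unfolding analytic_set_def by (intro exI[of _ "F k \<times> UNIV"]) auto
  moreover have "U = (\<Union>n. F n)"
  proof
    show "(\<Union>n. F n) \<subseteq> U" by (fastforce simp: F_def)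
    show "U \<subseteq> (\<Union>n. F n)"
    proof
      fix x assume "x \<in> U"
      then obtain r where "r > 0" "mball x r \<subseteq> U" using Uball by blast
      moreover obtain n where "inverse (real (Suc n)) < r"
        using small[OF \<open>r > 0\<close>] by blast
      ultimately have "mball x (inverse (real (Suc n))) \<subseteq> U"
        using mball_subset_concentric[of "inverse (real (Suc n))" r x] by (meson less_imp_le order_trans)
      then show "x \<in> (\<Union>n. F n)" using \<open>x \<in> U\<close> UM by (auto simp: F_def)
    qed
  qed
  ultimately show "\<exists>F :: nat \<Rightarrow> 'a set. (\<forall>n. analytic_set (F n)) \<and> U = (\<Union>n. F n)" by blast
qed

text \<open>Entry 0 of the sequence names a set \<open>B k\<close>, and the tail is a witness for
  that set.\<close>

lemma analytic_set_UN:
  fixes B :: "nat \<Rightarrow> 'a set"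
  assumes "\<And>k. analytic_set (B k)"
  shows "analytic_set (\<Union>k. B k)"
proof -
  obtain R where R: "\<And>k. cell_closed (R k)" "\<And>k. B k = fst ` R k"
    using assms unfolding analytic_set_def by metis
  define S where "S = {(x, y :: nat \<Rightarrow> nat). (x, \<lambda>n. y (Suc n)) \<in> R (y 0)}"
  have "cell_closed S"
  proof (rule cell_closedI)
    show "S \<subseteq> M \<times> UNIV" using cell_closed_subset[OF R(1)] by (auto simp: S_def)
    fix x :: 'a and y :: "nat \<Rightarrow> nat"
    assume x: "x \<in> M" and lim: "\<And>n. \<exists>q\<in>S. q \<in> cell n (x, y)"
    have "(x, \<lambda>n. y (Suc n)) \<in> R (y 0)"
    proof (rule cell_closedD[OF R(1)])
      fix n
      \<comment> \<open>One level more than needed for \<open>R (y 0)\<close>: the shift drops entry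
        0, which must agree as well.\<close>
      obtain u v where q: "(u, v) \<in> S" "(u, v) \<in> cell (Suc n) (x, y)" using lim by fastforce
      then have "v 0 = y 0" by (simp add: cell_def)
      moreover have "(u, v) \<in> cell n (x, y)" using q(2) cell_antimono[of n "Suc n"] by auto
      ultimately show "\<exists>q\<in>R (y 0). q \<in> cell n (x, \<lambda>n. y (Suc n))"
        using q by (intro bexI[of _ "(u, \<lambda>n. v (Suc n))"]) (auto simp: S_def cell_def)
    qed (use x in auto)
    then show "(x, y) \<in> S" by (simp add: S_def)
  qed
  moreover have "(\<Union>k. B k) = fst ` S"
  proof
    show "fst ` S \<subseteq> (\<Union>k. B k)" by (force simp: S_def R)
    show "(\<Union>k. B k) \<subseteq> fst ` S"
    proof
      fix x assume "x \<in> (\<Union>k. B k)"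
      then obtain k y where "(x, y) \<in> R k" by (auto simp: R)
      then have "(x, case_nat k y) \<in> S" by (simp add: S_def)
      then show "x \<in> fst ` S" by force
    qed
  qed
  ultimately show ?thesis unfolding analytic_set_def by blast
qed

text \<open>A single sequence stores a witness for every \<open>B k\<close>, the k-th one at the
  positions \<open>prod_encode (k, n)\<close>; closedness is then checked separately for each
  k.\<close>

lemma analytic_set_INT:
  fixes B :: "nat \<Rightarrow> 'a set"
  assumes "\<And>k. analytic_set (B k)"
  shows "analytic_set (\<Inter>k. B k)"
proof -
  obtain R where R: "\<And>k. cell_closed (R k)" "\<And>k. B k = fst ` R k"
    using assms unfolding analytic_set_def by metis
  define S where "S = {(x, y :: nat \<Rightarrow> nat). \<forall>k. (x, \<lambda>n. y (prod_encode (k, n))) \<in> R k}"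
  have "cell_closed S"
  proof (rule cell_closedI)
    show "S \<subseteq> M \<times> UNIV" using cell_closed_subset[OF R(1)] by (fastforce simp: S_def)
    fix x :: 'a and y :: "nat \<Rightarrow> nat"
    assume x: "x \<in> M" and lim: "\<And>n. \<exists>q\<in>S. q \<in> cell n (x, y)"
    have "(x, \<lambda>n. y (prod_encode (k, n))) \<in> R k" for k
    proof (rule cell_closedD[OF R(1)])
      fix n
      \<comment> \<open>A prefix of length \<open>N\<close> of the code contains the first
        \<open>n\<close> entries of row \<open>k\<close>, and \<open>N\<close> is at least
        \<open>n\<close>, so that the ball is small enough.\<close>
      define N where "N = n + (\<Sum>i<n. Suc (prod_encode (k, i)))"
      have N: "prod_encode (k, i) < N" if "i < n" for i
        using member_le_sum[of i "{..<n}" "\<lambda>i. Suc (prod_encode (k, i))"] that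
        by (auto simp: N_def)
      obtain u v where q: "(u, v) \<in> S" "(u, v) \<in> cell N (x, y)" using lim by fastforce
      then have "(u, v) \<in> cell n (x, y)"
        using cell_antimono[of n N] by (auto simp: N_def)
      with q N show "\<exists>q\<in>R k. q \<in> cell n (x, \<lambda>n. y (prod_encode (k, n)))"
        by (intro bexI[of _ "(u, \<lambda>n. v (prod_encode (k, n)))"]) (auto simp: S_def cell_def)
    qed (use x in auto)
    then show "(x, y) \<in> S" by (simp add: S_def)
  qed
  moreover have "(\<Inter>k. B k) = fst ` S"
  proof
    show "fst ` S \<subseteq> (\<Inter>k. B k)" by (force simp: S_def R)
    show "(\<Inter>k. B k) \<subseteq> fst ` S"
    proof
      fix x assume "x \<in> (\<Inter>k. B k)"
      then have "\<forall>k. \<exists>y. (x, y) \<in> R k" by (force simp: R)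
      then obtain y where "\<And>k. (x, y k) \<in> R k" by metis
      then have "(x, \<lambda>m. case prod_decode m of (k, n) \<Rightarrow> y k n) \<in> S" by (simp add: S_def)
      then show "x \<in> fst ` S" by force
    qed
  qed
  ultimately show ?thesis unfolding analytic_set_def by blast
qed

text \<open>Analytic sets need not have analytic complements, so the induction carries both claims.
  Complementation swaps them, and a countable union uses closure under unions for the set and under
  intersections for its complement.\<close>

lemma analytic_set_borel:
  assumes "B \<in> sigma_sets M {U. openin mtopology U}"
  shows "analytic_set B"
proof -
  have "analytic_set B \<and> analytic_set (M - B)"
    using assms
  proof induction
    case (Basic U)
    then have U: "openin mtopology U" by simp
    obtain F :: "nat \<Rightarrow> 'a set" where "\<And>n. analytic_set (F n)" "U = (\<Union>n. F n)"
      using analytic_set_openin(2)[OF U] by blast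
    then show ?case using analytic_set_UN analytic_set_openin(1)[OF U] by metis
  next
    case Empty
    have "cell_closed {}" by (auto simp: cell_closed_def)
    then have "analytic_set {}" by (auto simp: analytic_set_def)
    then show ?case using analytic_set_openin(1)[of "{}"] by simp
  next
    case (Compl A)
    moreover from Compl have "A \<subseteq> M"
      using sigma_sets_into_sp[of "{U. openin mtopology U}" M A] openin_subset by fastforce
    ultimately show ?case by (simp add: double_diff)
  next
    case (Union A)
    have "M - (\<Union>i. A i) = (\<Inter>i. M - A i)" by auto
    then show ?case using Union analytic_set_UN[of A] analytic_set_INT[of "\<lambda>i. M - A i"] by metis
  qed
  then show ?thesis ..
qed

section \<open>The binary splitting scheme and the perfect set theorem\<close>

text \<open>A Cantor-Bendixson argument: the points having a cell in which \<open>W\<close> projects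
  to a countable set have a countable projection altogether, so two of the other points differ in
  their first coordinates, and small cells about them cut out the two halves. Separation by a fixed
  distance, unlike mere disjointness, survives the passage to limits.\<close>

lemma split_uncountable_projection:
  assumes sep: "separable_space mtopology"
    and W: "W \<subseteq> M \<times> UNIV" "uncountable (fst ` W)"
  shows "\<exists>W' :: bool \<Rightarrow> ('a \<times> (nat \<Rightarrow> nat)) set. \<exists>c :: bool \<Rightarrow> 'a \<times> (nat \<Rightarrow> nat). \<exists>\<delta>>0.
    (\<forall>b. W' b \<subseteq> W \<inter> cell n (c b) \<and> uncountable (fst ` W' b)) \<and>
    (\<forall>p\<in>W' True. \<forall>q\<in>W' False. d (fst p) (fst q) \<ge> \<delta>)"
proof -
  obtain D where D: "countable D" "D \<subseteq> M" and dense: "mtopology closure_of D = M"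
    using sep by (auto simp: separable_space_def)
  \<comment> \<open>Countably many substitutes for the cells: centres in the dense set, prefixes as
    lists. With half the radius, a piece whose centre is that close to \<open>x\<close> stays inside
    the full ball about \<open>x\<close>.\<close>
  define piece where "piece c k s = {q. fst q \<in> mball c (inverse (Suc k) / 2) \<and> (\<forall>i<k. snd q i = s ! i)}"
    for c k and s :: "nat list"
  define I where "I = {(c, k, s). c \<in> D \<and> countable (fst ` (piece c k s \<inter> W))}"
  define core where "core = {p \<in> W. \<forall>k. uncountable (fst ` (cell k p \<inter> W))}"
  have "I \<subseteq> D \<times> UNIV" by (auto simp: I_def)
  then have "countable I" using D(1) by (meson countable_SIGMA countable_subset uncountable_def countableI_type)
  then have cI: "countable (\<Union>(c, k, s)\<in>I. fst ` (piece c k s \<inter> W))"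
    by (rule countable_UN) (auto simp: I_def)
  have "fst ` (W - core) \<subseteq> (\<Union>(c, k, s)\<in>I. fst ` (piece c k s \<inter> W))"
  proof
    fix x assume "x \<in> fst ` (W - core)"
    then obtain y where xy: "(x, y) \<in> W" "(x, y) \<notin> core" by auto
    then obtain k where k: "countable (fst ` (cell k (x, y) \<inter> W))" by (auto simp: core_def)
    have x: "x \<in> M" using xy W by auto
    have "mball x (inverse (Suc k) / 2) \<noteq> {}"
      using x centre_in_mball_iff[of x "inverse (Suc k) / 2"] by fastforce
    then have "D \<inter> mball x (inverse (Suc k) / 2) \<noteq> {}"
      using dense dense_intersects_open[of mtopology D] openin_mball topspace_mtopology by metis
    then obtain c where c: "c \<in> D" "d x c < inverse (Suc k) / 2" by auto
    define s where "s = map y [0..<k]"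
    have "piece c k s \<subseteq> cell k (x, y)"
    proof
      fix q assume q: "q \<in> piece c k s"
      then have "d x (fst q) < inverse (Suc k)"
        using c x triangle[of x c "fst q"] by (auto simp: piece_def)
      then show "q \<in> cell k (x, y)" using q x by (auto simp: piece_def cell_def s_def)
    qed
    then have "fst ` (piece c k s \<inter> W) \<subseteq> fst ` (cell k (x, y) \<inter> W)" by blast
    then have "countable (fst ` (piece c k s \<inter> W))" using k countable_subset by blast
    then have "(c, k, s) \<in> I" using c by (simp add: I_def)
    moreover have "(x, y) \<in> piece c k s"
      using c x D by (auto simp: piece_def s_def commute)
    ultimately show "x \<in> (\<Union>(c, k, s)\<in>I. fst ` (piece c k s \<inter> W))" using xy(1) by force
  qed
  then have "countable (fst ` (W - core))" using cI countable_subset by blast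
  moreover have "fst ` W \<subseteq> fst ` (W - core) \<union> fst ` core" by blast
  ultimately have "uncountable (fst ` core)"
    using W(2) by (meson countable_Un countable_subset)
  then obtain u where u: "u \<in> core" by fastforce
  have "\<not> fst ` core \<subseteq> {fst u}"
    using \<open>uncountable (fst ` core)\<close> countable_subset[of "fst ` core" "{fst u}"] by auto
  then obtain x where "x \<in> fst ` core" "fst u \<noteq> x" unfolding subset_iff singleton_iff by metis
  then obtain v where "v \<in> core" "fst u \<noteq> fst v" by (elim imageE) simp
  with u have uv: "u \<in> core" "v \<in> core" "fst u \<noteq> fst v" by auto
  then have M: "fst u \<in> M" "fst v \<in> M" using W by (auto simp: core_def)
  then have "d (fst u) (fst v) / 4 > 0" using uv mdist_pos_less by simp
  then obtain j where j: "inverse (real (Suc j)) < d (fst u) (fst v) / 4"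
    using reals_Archimedean by blast
  \<comment> \<open>Level \<open>n\<close> gives cells of the requested size. Level \<open>j\<close>
    keeps the points of the halves within a quarter of the distance between the centres, hence more
    than half of it apart.\<close>
  define k where "k = max n j"
  define c where "c b = (if b then u else v)" for b
  define W' where "W' b = cell k (c b) \<inter> W" for b
  have "d (fst p) (fst q) \<ge> d (fst u) (fst v) / 4" if "p \<in> W' True" "q \<in> W' False" for p q
  proof -
    have "p \<in> cell j u" "q \<in> cell j v"
      using that cell_antimono[of j k u] cell_antimono[of j k v] by (auto simp: W'_def c_def k_def)
    then have "fst p \<in> M" "fst q \<in> M" "d (fst u) (fst p) < d (fst u) (fst v) / 4"
      "d (fst v) (fst q) < d (fst u) (fst v) / 4" using j by (auto simp: cell_def)
    moreover from this have "d (fst u) (fst v) \<le> d (fst u) (fst p) + d (fst p) (fst v)"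
      "d (fst p) (fst v) \<le> d (fst p) (fst q) + d (fst v) (fst q)"
      using M triangle triangle' by auto
    ultimately show ?thesis using nonneg[of "fst u" "fst v"] by linarith
  qed
  moreover have "W' b \<subseteq> W \<inter> cell n (c b)" for b
    using cell_antimono[of n k "c b"] by (auto simp: W'_def k_def)
  moreover have "uncountable (fst ` W' b)" for b
    using uv(1,2) by (cases b) (simp_all add: W'_def c_def core_def)
  ultimately show ?thesis using \<open>d (fst u) (fst v) / 4 > 0\<close>
    by (intro exI[of _ W'] exI[of _ c] exI[of _ "d (fst u) (fst v) / 4"]) simp
qed

text \<open>Makes \<open>k div 2\<close> the parent index in the tree of dyadic intervals.\<close>

lemma floor_pow2_Suc_div2: "\<lfloor>2 ^ Suc n * t\<rfloor> div 2 = \<lfloor>2 ^ n * (t::real)\<rfloor>"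
  using floor_divide_real_eq_div[of 2 "2 ^ Suc n * t"] by simp

text \<open>The binary digits of t select a branch of repeatedly split sets, which shrinks to a
  limit point in \<open>R\<close> with first coordinate \<open>h t\<close>. Shrinking makes
  \<open>h\<close> measurable, and the distance between siblings makes it injective. Every tree has
  root \<open>R\<close>, so injectivity is claimed only within a unit interval.\<close>

lemma uncountable_borel_embedding:
  assumes sep: "separable_space mtopology" and complete: mcomplete
    and N: "space N = M" "sets N = sigma_sets M {U. openin mtopology U}"
    and B: "B \<in> sets N" "uncountable B"
  shows "\<exists>h :: real \<Rightarrow> 'a. h \<in> borel \<rightarrow>\<^sub>M N \<and> range h \<subseteq> B \<and>
    (\<forall>s t. \<lfloor>s\<rfloor> = \<lfloor>t\<rfloor> \<longrightarrow> h s = h t \<longrightarrow> s = t)"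
proof -
  obtain R where R: "cell_closed R" "B = fst ` R"
    using analytic_set_borel B(1) unfolding N(2) analytic_set_def by blast
  define fat where "fat W \<longleftrightarrow> W \<subseteq> M \<times> UNIV \<and> uncountable (fst ` W)"
    for W :: "('a \<times> (nat \<Rightarrow> nat)) set"
  define splits where "splits n W X \<longleftrightarrow> (case X of (W', c, \<delta>) \<Rightarrow> \<delta> > 0 \<and>
      (\<forall>b. W' b \<subseteq> W \<inter> cell n (c b) \<and> uncountable (fst ` W' b)) \<and>
      (\<forall>p\<in>W' True. \<forall>q\<in>W' False. d (fst p) (fst q) \<ge> \<delta>))"
    for n W and X :: "(bool \<Rightarrow> ('a \<times> (nat \<Rightarrow> nat)) set) \<times> (bool \<Rightarrow> 'a \<times> (nat \<Rightarrow> nat)) \<times> real"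
  have "\<exists>X. splits n W X" if "fat W" for n W
    using split_uncountable_projection[OF sep, of W n] that
    unfolding fat_def splits_def split_paired_Ex by simp
  then have "\<forall>n W. \<exists>X. fat W \<longrightarrow> splits n W X" by simp
  then obtain X where X: "\<And>n W. fat W \<Longrightarrow> splits n W (X n W)" unfolding choice_iff by auto
  define S where "S n W = fst (X n W)" for n W
  define c where "c n W = fst (snd (X n W))" for n W
  define \<delta> where "\<delta> n W = snd (snd (X n W))" for n W
  have S: "\<delta> n W > 0" "S n W b \<subseteq> W" "S n W b \<subseteq> cell n (c n W b)" "fat (S n W b)"
      "p \<in> S n W True \<Longrightarrow> q \<in> S n W False \<Longrightarrow> d (fst p) (fst q) \<ge> \<delta> n W"
    if "fat W" for n W b p q
    using X[OF that, of n] that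
    by (simp_all add: splits_def S_def c_def \<delta>_def fat_def case_prod_beta subset_iff) blast
  \<comment> \<open>The nodes of the binary tree at level \<open>n\<close> are indexed by the dyadic intervals
      \<open>{t. \<lfloor>2 ^ n * t\<rfloor> = k}\<close>, whose parent has index \<open>k div 2\<close>; there is one tree per unit interval.\<close>
  define V where "V = rec_nat (\<lambda>_. R) (\<lambda>n W k. S n (W (k div 2)) (even (k :: int)))"
  have V0: "V 0 k = R" and VSuc: "V (Suc n) k = S n (V n (k div 2)) (even k)" for n k
    by (simp_all add: V_def)
  have fat: "fat (V n k)" for n k
  proof (induction n arbitrary: k)
    case 0
    then show ?case using R B cell_closed_subset by (auto simp: V0 fat_def)
  qed (simp add: VSuc S(4))
  define G where "G n t = V n \<lfloor>2 ^ n * t\<rfloor>" for n and t :: real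
  have GSuc: "G (Suc n) t = S n (G n t) (even \<lfloor>2 ^ Suc n * t\<rfloor>)" for n t
    unfolding G_def VSuc by (simp only: floor_pow2_Suc_div2)
  have Gfat: "fat (G n t)" for n t by (simp add: G_def fat)
  have Gmono: "G n t \<subseteq> G m t" if "m \<le> n" for m n t
    using that by (induction rule: dec_induct) (auto simp: GSuc dest!: subsetD[OF S(2)[OF Gfat]])
  \<comment> \<open>The sets \<open>G n t\<close> need not be closed, so the limit is only shown to
    be approximated by points of each of them. Membership in \<open>R\<close> follows later from
    closedness of \<open>R\<close>.\<close>
  have "\<exists>x\<in>M. \<exists>y. \<forall>j n. \<exists>q\<in>G n t. q \<in> cell j (x, y)" for t
  proof -
    have "G n t \<noteq> {}" for n using Gfat[of n t] by (auto simp: fat_def)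
    then have "\<exists>p. p \<in> G n t" for n by blast
    then obtain p where p: "\<And>n. p n \<in> G n t" by metis
    \<comment> \<open>The centre of the level-\<open>n\<close> cell that contains
      \<open>G (Suc n) t\<close>, and therefore all later \<open>p m\<close>.\<close>
    define z where "z n = c n (G n t) (even \<lfloor>2 ^ Suc n * t\<rfloor>)" for n
    have pz: "p m \<in> cell n (z n)" if "Suc n \<le> m" for m n
      using p[of m] Gmono[OF that, of t] S(3)[OF Gfat, of n n t] by (auto simp: GSuc z_def)
    have pM: "fst (p n) \<in> M" for n using p[of n] Gfat[of n t] by (auto simp: fat_def)
    have "MCauchy (\<lambda>n. fst (p n))"
      unfolding MCauchy_def
    proof (intro conjI allI impI)
      fix \<epsilon> :: real assume "\<epsilon> > 0"
      then obtain n where n: "inverse (real (Suc n)) < \<epsilon> / 2"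
        using reals_Archimedean[of "\<epsilon> / 2"] by auto
      have "d (fst (p m)) (fst (p m')) < \<epsilon>" if "Suc n \<le> m" "Suc n \<le> m'" for m m'
        using pz[OF that(1)] pz[OF that(2)] n triangle''[of "fst (p m)" "fst (z n)" "fst (p m')"]
        by (auto simp: cell_def simp del: of_nat_Suc)
      then show "\<exists>N. \<forall>n n'. N \<le> n \<longrightarrow> N \<le> n' \<longrightarrow> d (fst (p n)) (fst (p n')) < \<epsilon>" by blast
    qed (use pM in auto)
    then obtain x where "limitin mtopology (\<lambda>n. fst (p n)) x sequentially"
      using complete unfolding mcomplete_def by blast
    then have x: "x \<in> M" and lim: "\<And>\<epsilon>. \<epsilon> > 0 \<Longrightarrow> \<exists>N. \<forall>n\<ge>N. fst (p n) \<in> M \<and> d (fst (p n)) x < \<epsilon>"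
      by (auto simp: limit_metric_sequentially)
    \<comment> \<open>A cell of level \<open>Suc i\<close> is the first to fix entry
      \<open>i\<close>, and all later points of the branch share that entry.\<close>
    define y where "y i = snd (z (Suc i)) i" for i
    have "\<exists>q\<in>G n t. q \<in> cell j (x, y)" for j n
    proof -
      obtain N where N: "\<And>m. m \<ge> N \<Longrightarrow> d (fst (p m)) x < inverse (real (Suc j))"
        using lim[of "inverse (real (Suc j))"] by auto
      \<comment> \<open>Late enough for the metric limit (\<open>N\<close>), for nestedness
        (\<open>n\<close>) and for the first \<open>j\<close> digits, of which digit
        \<open>i\<close> is fixed from index \<open>i + 2\<close> on.\<close>
      define m where "m = N + n + j + 2"
      have "snd (p m) i = y i" if "i < j" for i
        using pz[of "Suc i" m] that by (auto simp: cell_def m_def y_def)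
      then have "p m \<in> cell j (x, y)"
        using x pM[of m] N[of m] by (auto simp: cell_def m_def commute[of x] simp del: of_nat_Suc)
      moreover have "p m \<in> G n t" using p[of m] Gmono[of n m t] by (auto simp: m_def)
      ultimately show ?thesis by blast
    qed
    then show ?thesis using x by blast
  qed
  then obtain h g where hM: "\<And>t. h t \<in> M" and hg: "\<And>t j n. \<exists>q\<in>G n t. q \<in> cell j (h t, g t)"
    by metis
  have "(h t, g t) \<in> R" for t
    using hg[of 0 t] hM by (intro cell_closedD[OF R(1)]) (auto simp: G_def V0)
  then have "range h \<subseteq> B" by (force simp: R)
  moreover have "h \<in> borel \<rightarrow>\<^sub>M N"
  proof (rule measurable_sigma_sets[OF N(2)])
    show "{U. openin mtopology U} \<subseteq> Pow M" using openin_subset by fastforce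
    show "h \<in> space borel \<rightarrow> M" using hM by simp
    fix U assume "U \<in> {U. openin mtopology U}"
    then have U: "openin mtopology U" by simp
    \<comment> \<open>There are only countably many dyadic intervals, so it suffices that the
      preimage of an open set is a union of such intervals.\<close>
    define K where "K = {(n, k). {t. \<lfloor>2 ^ n * t\<rfloor> = k} \<subseteq> h -` U}"
    have "h -` U = (\<Union>(n, k)\<in>K. {t. \<lfloor>2 ^ n * t\<rfloor> = k})"
    proof (intro set_eqI iffI)
      fix t assume "t \<in> h -` U"
      then obtain r where r: "r > 0" "mball (h t) r \<subseteq> U"
        using U by (auto simp: openin_mtopology)
      \<comment> \<open>A quarter of \<open>r\<close> to go from the cell's centre to
        \<open>q\<close> and another from \<open>q\<close> to \<open>h u\<close>; two points within
        \<open>r / 2\<close> of the same centre are then less than \<open>r\<close> apart.\<close>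
      obtain n where n: "inverse (real (Suc n)) < r / 4"
        using reals_Archimedean[of "r / 4"] r by auto
      have near: "h u \<in> mball (fst (c n (G n t) (even \<lfloor>2 ^ Suc n * t\<rfloor>))) (r / 2)"
        if "\<lfloor>2 ^ Suc n * u\<rfloor> = \<lfloor>2 ^ Suc n * t\<rfloor>" for u
      proof -
        let ?c = "c n (G n t) (even \<lfloor>2 ^ Suc n * t\<rfloor>)"
        obtain q where q: "q \<in> G (Suc n) u" "q \<in> cell n (h u, g u)" using hg by blast
        have "G (Suc n) u = G (Suc n) t" using that by (simp only: G_def)
        then have "q \<in> cell n ?c" using q S(3)[OF Gfat, of n n t] GSuc[of n t] by auto
        then show ?thesis
          using q(2) n triangle[of "fst ?c" "fst q" "h u"] commute[of "h u" "fst q"]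
          by (auto simp: cell_def simp del: of_nat_Suc)
      qed
      have "h u \<in> U" if "\<lfloor>2 ^ Suc n * u\<rfloor> = \<lfloor>2 ^ Suc n * t\<rfloor>" for u
      proof -
        let ?c = "fst (c n (G n t) (even \<lfloor>2 ^ Suc n * t\<rfloor>))"
        have "h u \<in> mball ?c (r / 2)" "h t \<in> mball ?c (r / 2)" using near that by auto
        then have "h u \<in> mball (h t) r" using triangle''[of "h t" ?c "h u"] by auto
        then show ?thesis using r by blast
      qed
      then have "(Suc n, \<lfloor>2 ^ Suc n * t\<rfloor>) \<in> K" by (auto simp: K_def)
      then show "t \<in> (\<Union>(n, k)\<in>K. {t. \<lfloor>2 ^ n * t\<rfloor> = k})" by blast
    qed (auto simp: K_def)
    moreover have "(\<Union>(n, k)\<in>K. {t :: real. \<lfloor>2 ^ n * t\<rfloor> = k}) \<in> sets borel"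
    proof (rule sets.countable_UN'')
      fix i :: "nat \<times> int"
      have "{t \<in> space borel. \<lfloor>2 ^ fst i * t\<rfloor> = snd i} \<in> sets (borel :: real measure)" by measurable
      then show "(case i of (n, k) \<Rightarrow> {t :: real. \<lfloor>2 ^ n * t\<rfloor> = k}) \<in> sets borel"
        by (simp add: case_prod_beta)
    qed auto
    ultimately show "h -` U \<inter> space borel \<in> sets borel" by simp
  qed
  moreover have "s = t" if same: "\<lfloor>s\<rfloor> = \<lfloor>t\<rfloor>" "h s = h t" for s t
  proof (rule ccontr)
    assume "s \<noteq> t"
    have ex: "\<exists>n. \<lfloor>2 ^ n * s\<rfloor> \<noteq> \<lfloor>2 ^ n * t\<rfloor>"
    proof (rule ccontr)
      assume "\<not> ?thesis"
      then have eq: "\<lfloor>2 ^ n * s\<rfloor> = \<lfloor>2 ^ n * t\<rfloor>" for n by simp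
      have "\<bar>2 ^ n * s - 2 ^ n * t\<bar> < 1" for n using eq[of n] by linarith
      then have "2 ^ n * \<bar>s - t\<bar> < 1" for n
        by (metis abs_mult abs_numeral power_abs right_diff_distrib)
      moreover obtain n where "1 / \<bar>s - t\<bar> < 2 ^ n" using real_arch_pow[of 2] by auto
      ultimately show False using \<open>s \<noteq> t\<close> by (smt (verit) divide_less_eq zero_less_abs_iff)
    qed
    \<comment> \<open>At the first level where the dyadic intervals differ, they have the same
      parent, so \<open>s\<close> and \<open>t\<close> enter opposite halves of one split. This
      level is positive because the integer parts agree.\<close>
    define n where "n = (LEAST n. \<lfloor>2 ^ n * s\<rfloor> \<noteq> \<lfloor>2 ^ n * t\<rfloor>)"
    have n: "\<lfloor>2 ^ n * s\<rfloor> \<noteq> \<lfloor>2 ^ n * t\<rfloor>" unfolding n_def by (rule LeastI_ex[OF ex])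
    have "n \<noteq> 0" using n same by (cases n) auto
    then obtain m where m: "n = Suc m" using not0_implies_Suc by blast
    then have eq: "\<lfloor>2 ^ m * s\<rfloor> = \<lfloor>2 ^ m * t\<rfloor>"
      using not_less_Least[of m "\<lambda>n. \<lfloor>2 ^ n * s\<rfloor> \<noteq> \<lfloor>2 ^ n * t\<rfloor>"] by (auto simp: n_def)
    have parity: "even \<lfloor>2 ^ Suc m * t\<rfloor> = (\<not> even \<lfloor>2 ^ Suc m * s\<rfloor>)"
    proof (rule ccontr)
      assume "\<not> ?thesis"
      then have *: "even \<lfloor>2 ^ Suc m * s\<rfloor> = even \<lfloor>2 ^ Suc m * t\<rfloor>" by blast
      have "\<lfloor>2 ^ Suc m * s\<rfloor> div 2 = \<lfloor>2 ^ Suc m * t\<rfloor> div 2"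
        using eq by (simp only: floor_pow2_Suc_div2)
      moreover have "a = b" if "a div 2 = b div 2" "even a = even b" for a b :: int
        using that by presburger
      ultimately show False using * n m by blast
    qed
    have "G m s = G m t" using eq by (simp add: G_def)
    then obtain b where b: "G (Suc m) s = S m (G m t) b" "G (Suc m) t = S m (G m t) (\<not> b)"
      using GSuc[of m s] GSuc[of m t] unfolding parity by simp
    define e where "e = \<delta> m (G m t)"
    have "e > 0" using S(1) Gfat by (simp add: e_def)
    then obtain j where j: "inverse (real (Suc j)) < e / 2" using reals_Archimedean[of "e / 2"] by auto
    \<comment> \<open>Points of the two halves approximating the common value
      \<open>h s = h t\<close> within \<open>e / 2\<close> would be closer together than the
      separation \<open>e\<close> allows.\<close>
    obtain p q where pq: "p \<in> G (Suc m) s" "p \<in> cell j (h s, g s)"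
      "q \<in> G (Suc m) t" "q \<in> cell j (h t, g t)" using hg by meson
    have "d (fst p) (fst q) \<ge> e"
      using S(5)[OF Gfat, of p m m t q] S(5)[OF Gfat, of q m m t p] pq b
      by (cases b) (auto simp: e_def commute)
    moreover have "d (fst p) (fst q) < e"
      using pq j same triangle''[of "fst p" "h s" "fst q"] by (auto simp: cell_def simp del: of_nat_Suc)
    ultimately show False by simp
  qed
  ultimately show ?thesis by blast
qed

end

section \<open>Non-atomic measures with equal mass on given blocks\<close>

text \<open>By separability, countably many balls of any fixed radius cover an atom, so one of them
  meets it in positive measure and hence carries all its mass. Intersecting over radii 1/(n+1)
  leaves at most one point with the full mass, which is impossible.\<close>

lemma (in Metric_space) nonatomic_if_singletons_null:
  assumes sep: "separable_space mtopology"
    and \<mu>: "finite_measure \<mu>" "space \<mu> = M" "sets \<mu> = sigma_sets M {U. openin mtopology U}"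
    and null: "\<And>x S. S \<in> sets \<mu> \<Longrightarrow> S \<subseteq> {x} \<Longrightarrow> measure \<mu> S = 0"
  shows "nonatomic \<mu>"
  unfolding nonatomic_def
proof (intro ballI impI, rule ccontr)
  interpret finite_measure \<mu> by fact
  fix A assume A: "A \<in> sets \<mu>" "measure \<mu> A > 0"
    and atom: "\<not> (\<exists>B\<in>sets \<mu>. B \<subseteq> A \<and> 0 < measure \<mu> B \<and> measure \<mu> B < measure \<mu> A)"
  obtain D where D: "countable D" "D \<subseteq> M" and dense: "mtopology closure_of D = M"
    using sep by (auto simp: separable_space_def)
  have ball: "mball x r \<in> sets \<mu>" for x r
    unfolding \<mu>(3) by (rule sigma_sets.Basic) simp
  have AM: "A \<subseteq> M" using sets.sets_into_space[OF A(1)] \<mu>(2) by simp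
  have "\<exists>c\<in>D. A - mball c (inverse (Suc n)) \<in> null_sets \<mu>" for n
  proof -
    let ?r = "inverse (real (Suc n))"
    have cover: "A = (\<Union>c\<in>D. A \<inter> mball c ?r)"
    proof
      show "A \<subseteq> (\<Union>c\<in>D. A \<inter> mball c ?r)"
      proof
        fix x assume x: "x \<in> A"
        then have "mball x ?r \<noteq> {}" using AM centre_in_mball_iff[of x ?r] by fastforce
        then have "D \<inter> mball x ?r \<noteq> {}"
          using dense dense_intersects_open[of mtopology D] openin_mball topspace_mtopology by metis
        then obtain c where "c \<in> D" "c \<in> mball x ?r" by blast
        then show "x \<in> (\<Union>c\<in>D. A \<inter> mball c ?r)"
          using x AM D(2) by (auto simp: commute intro!: bexI[of _ c])
      qed
    qed auto
    have "\<exists>c\<in>D. A \<inter> mball c ?r \<notin> null_sets \<mu>"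
    proof (rule ccontr)
      assume "\<not> ?thesis"
      then have "(\<Union>c\<in>D. A \<inter> mball c ?r) \<in> null_sets \<mu>"
        using D(1) by (intro null_sets_UN') auto
      then show False using A cover by (metis measure_eq_0_null_sets less_irrefl)
    qed
    then obtain c where c: "c \<in> D" "A \<inter> mball c ?r \<notin> null_sets \<mu>" by blast
    have "A \<inter> mball c ?r \<in> sets \<mu>" using A ball by blast
    moreover from this have "measure \<mu> (A \<inter> mball c ?r) > 0"
      using c(2) by (auto simp: null_sets_def emeasure_eq_measure zero_less_measure_iff)
    ultimately have "measure \<mu> (A \<inter> mball c ?r) = measure \<mu> A"
      using atom finite_measure_mono[of "A \<inter> mball c ?r" A] A(1) by (metis inf_le1 le_less)
    then have "measure \<mu> (A - mball c ?r) = 0"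
      using finite_measure_Diff'[OF A(1) ball, of c ?r] by simp
    then have "A - mball c ?r \<in> null_sets \<mu>"
      using A(1) ball by (auto simp: null_sets_def emeasure_eq_measure)
    with c show ?thesis by blast
  qed
  then obtain c where c: "\<And>n. c n \<in> D" "\<And>n. A - mball (c n) (inverse (Suc n)) \<in> null_sets \<mu>"
    by metis
  define S where "S = A \<inter> (\<Inter>n. mball (c n) (inverse (Suc n)))"
  have S: "S \<in> sets \<mu>" unfolding S_def using A(1) ball by auto
  have null_UN: "(\<Union>n. A - mball (c n) (inverse (Suc n))) \<in> null_sets \<mu>"
    using c(2) by (intro null_sets_UN') auto
  have "S = A - (\<Union>n. A - mball (c n) (inverse (Suc n)))" unfolding S_def by blast
  then have "measure \<mu> S = measure \<mu> A"
    by (simp only: measure_Diff_null_set[OF A(1) null_UN])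
  moreover have "x = y" if "x \<in> S" "y \<in> S" for x y
  proof (rule ccontr)
    assume "x \<noteq> y"
    have M: "x \<in> M" "y \<in> M" using that AM by (auto simp: S_def)
    then have "d x y / 2 > 0" using \<open>x \<noteq> y\<close> mdist_pos_less by simp
    then obtain n where n: "inverse (real (Suc n)) < d x y / 2" using reals_Archimedean by blast
    have "d (c n) x < inverse (Suc n)" "d (c n) y < inverse (Suc n)" "c n \<in> M"
      using that by (auto simp: S_def)
    then show False using triangle''[of x "c n" y] M n by simp
  qed
  then have "\<exists>x. S \<subseteq> {x}" by blast
  then have "measure \<mu> S = 0" using null[OF S] by blast
  ultimately show False using A(2) by simp
qed

text \<open>The embeddings into the blocks are glued, with [i, i+1) going to \<open>B i\<close>, and
  the uniform measure on [0, N) is pushed forward. The glued map is injective on [0, N), so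
  singletons are null.\<close>

lemma exists_nonatomic_prob_on_blocks:
  fixes M :: "'a measure" and B :: "nat \<Rightarrow> 'a set" and N :: nat
  assumes M: "standard_borel M" and N: "N > 0"
    and B: "\<And>i. i < N \<Longrightarrow> B i \<in> sets M" "\<And>i. i < N \<Longrightarrow> uncountable (B i)"
    and disj: "\<And>i j. i < N \<Longrightarrow> j < N \<Longrightarrow> i \<noteq> j \<Longrightarrow> B i \<inter> B j = {}"
  shows "\<exists>\<mu>\<in>nonatomic_probs M. \<forall>i<N. measure \<mu> (B i) = 1 / N"
proof -
  obtain X where X: "completely_metrizable_space X" "separable_space X" "topspace X = space M"
    "sets M = sigma_sets (topspace X) {U. openin X U}"
    using M by (auto simp: standard_borel_def Polish_space_def)
  obtain S d where S: "Metric_space S d" "Metric_space.mcomplete S d" "X = Metric_space.mtopology S d"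
    using X(1) by (auto simp: completely_metrizable_space_def)
  interpret Metric_space S d by fact
  have spM: "space M = S" using X(3) S(3) by simp
  have setsM: "sets M = sigma_sets S {U. openin mtopology U}" using X(4) S(3) by simp
  have sep: "separable_space mtopology" using X S by simp
  \<comment> \<open>Indices beyond the blocks fall back on block 0, which exists as
    \<open>N > 0\<close>: gluing along \<open>nat \<lfloor>t\<rfloor>\<close> needs a measurable map
    for every natural number.\<close>
  have "\<exists>h :: real \<Rightarrow> 'a. h \<in> borel \<rightarrow>\<^sub>M M \<and> range h \<subseteq> B (if i < N then i else 0) \<and>
      (\<forall>s t. \<lfloor>s\<rfloor> = \<lfloor>t\<rfloor> \<longrightarrow> h s = h t \<longrightarrow> s = t)" for i
    using B N by (intro uncountable_borel_embedding sep S spM setsM) auto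
  then obtain h where h: "\<And>i. h i \<in> borel \<rightarrow>\<^sub>M M" "\<And>i. range (h i) \<subseteq> B (if i < N then i else 0)"
    "\<And>i s t. \<lfloor>s\<rfloor> = \<lfloor>t\<rfloor> \<Longrightarrow> h i s = h i t \<Longrightarrow> s = (t::real)"
    by metis
  define H where "H t = h (nat \<lfloor>t\<rfloor>) t" for t
  have Hm: "H \<in> borel \<rightarrow>\<^sub>M M" unfolding H_def
    by (rule measurable_compose_countable[OF h(1)]) measurable
  have HB: "H t \<in> B (nat \<lfloor>t\<rfloor>)" "nat \<lfloor>t\<rfloor> < N" if "t \<in> {0..<real N}" for t
  proof -
    show *: "nat \<lfloor>t\<rfloor> < N" using that by (auto simp: nat_less_iff floor_less_iff)
    show "H t \<in> B (nat \<lfloor>t\<rfloor>)" using h(2)[of "nat \<lfloor>t\<rfloor>"] * unfolding H_def by auto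
  qed
  have H_iff: "H t \<in> B i \<longleftrightarrow> nat \<lfloor>t\<rfloor> = i" if "t \<in> {0..<real N}" "i < N" for t i
    using HB[OF that(1)] disj[of "nat \<lfloor>t\<rfloor>" i] that(2) by blast
  have Hinj: "s = t" if st: "s \<in> {0..<real N}" "t \<in> {0..<real N}" and "H s = H t" for s t
  proof -
    have "nat \<lfloor>s\<rfloor> = nat \<lfloor>t\<rfloor>" using H_iff[of s "nat \<lfloor>t\<rfloor>"] HB[of t] that by simp
    moreover have "\<lfloor>s\<rfloor> \<ge> 0" "\<lfloor>t\<rfloor> \<ge> 0" using st by auto
    ultimately have "\<lfloor>s\<rfloor> = \<lfloor>t\<rfloor>" by linarith
    then show ?thesis using h(3)[of s t "nat \<lfloor>t\<rfloor>"] \<open>H s = H t\<close> by (simp add: H_def)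
  qed
  define \<nu> where "\<nu> = uniform_measure lborel {0..<real N}"
  have \<nu>: "prob_space \<nu>" unfolding \<nu>_def using N by (intro prob_space_uniform_measure) auto
  have Hm\<nu>: "H \<in> \<nu> \<rightarrow>\<^sub>M M" using Hm by (simp add: \<nu>_def)
  define \<mu> where "\<mu> = distr \<nu> M H"
  have pr: "prob_space \<mu>" unfolding \<mu>_def by (rule prob_space.prob_space_distr[OF \<nu> Hm\<nu>])
  have m\<mu>: "measure \<mu> E = measure lborel ({0..<real N} \<inter> H -` E) / N" if "E \<in> sets M" for E
  proof -
    have "H -` E \<in> sets borel" using measurable_sets[OF Hm that] by simp
    then have "measure \<nu> (H -` E) = measure lborel ({0..<real N} \<inter> H -` E) / N"
      unfolding \<nu>_def using N by (subst measure_uniform_measure) auto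
    then show ?thesis unfolding \<mu>_def using measure_distr[OF Hm\<nu> that] by (simp add: \<nu>_def)
  qed
  have "nonatomic \<mu>"
  proof (rule nonatomic_if_singletons_null[OF sep])
    show "finite_measure \<mu>" using pr by (simp add: prob_space_def)
    show "space \<mu> = S" "sets \<mu> = sigma_sets S {U. openin mtopology U}"
      by (simp_all add: \<mu>_def spM setsM)
    fix x E assume E: "E \<in> sets \<mu>" "E \<subseteq> {x}"
    have "\<exists>t. {0..<real N} \<inter> H -` E \<subseteq> {t}"
    proof (cases "{0..<real N} \<inter> H -` E = {}")
      case False
      then obtain t where t: "t \<in> {0..<real N}" "H t \<in> E" by blast
      have "s = t" if "s \<in> {0..<real N}" "H s \<in> E" for s
        using Hinj[OF that(1) t(1)] E(2) t(2) that(2) by blast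
      then show ?thesis by blast
    qed auto
    then obtain t where "{0..<real N} \<inter> H -` E \<subseteq> {t}" ..
    then have "{0..<real N} \<inter> H -` E = {} \<or> {0..<real N} \<inter> H -` E = {t}" by blast
    then have "measure lborel ({0..<real N} \<inter> H -` E) = 0" by (elim disjE) simp_all
    then show "measure \<mu> E = 0" using m\<mu>[of E] E(1) by (simp add: \<mu>_def)
  qed
  moreover have "measure \<mu> (B i) = 1 / N" if i: "i < N" for i
  proof -
    have "{0..<real N} \<inter> H -` B i = {real i..<real i + 1}"
    proof (intro set_eqI iffI)
      fix t assume "t \<in> {0..<real N} \<inter> H -` B i"
      then have t: "t \<in> {0..<real N}" "nat \<lfloor>t\<rfloor> = i" using H_iff i by auto
      then show "t \<in> {real i..<real i + 1}" by (auto; linarith)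
    next
      fix t assume t: "t \<in> {real i..<real i + 1}"
      then have "t \<in> {0..<real N}" using i by auto
      moreover have "nat \<lfloor>t\<rfloor> = i" using t by (auto; linarith)
      ultimately show "t \<in> {0..<real N} \<inter> H -` B i" using H_iff i by blast
    qed
    then show ?thesis using m\<mu>[OF B(1)[OF i]] by simp
  qed
  moreover have "sets \<mu> = sets M" by (simp add: \<mu>_def)
  ultimately show ?thesis using pr by (auto simp: nonatomic_probs_def intro!: bexI[of _ \<mu>])
qed

section \<open>Averaging the error over the shattering concepts\<close>

lemma sum_Pow_pair:
  fixes f :: "'b set \<Rightarrow> real"
  assumes A: "finite A" "j \<in> A" and pair: "\<And>J. J \<subseteq> A - {j} \<Longrightarrow> f J + f (insert j J) = c"
  shows "(\<Sum>J\<in>Pow A. f J) = 2 ^ (card A - 1) * c"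
proof -
  let ?P = "Pow (A - {j})"
  have "Pow A = ?P \<union> insert j ` ?P" using Pow_insert[of j "A - {j}"] A by (simp add: insert_absorb)
  moreover have "?P \<inter> insert j ` ?P = {}" by blast
  moreover have "inj_on (insert j) ?P" by (rule inj_onI) (auto simp: insert_eq_iff)
  ultimately have "(\<Sum>J\<in>Pow A. f J) = (\<Sum>J\<in>?P. f J + f (insert j J))"
    using A by (simp add: sum.union_disjoint sum.reindex sum.distrib)
  also have "\<dots> = (\<Sum>J\<in>?P. c)" using pair by (intro sum.cong) auto
  finally show ?thesis using A by (simp add: card_Pow)
qed

text \<open>At least half of the blocks contain no sample point. For such a block j, the concepts of
  \<open>J\<close> and \<open>insert j J\<close> label the sample alike, so the learner returns the
  same set for both, and its two errors on \<open>B j\<close> add up to the whole mass 1/N.\<close>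

lemma sum_err_lower_bound:
  fixes B :: "nat \<Rightarrow> 'a set" and C :: "nat set \<Rightarrow> 'a set"
  assumes \<mu>: "prob_space \<mu>" and N: "N > 0" "2 * m \<le> N"
    and B: "\<And>i. i < N \<Longrightarrow> B i \<in> sets \<mu>" "\<And>i. i < N \<Longrightarrow> measure \<mu> (B i) = 1 / N"
    and disj: "\<And>i j. i < N \<Longrightarrow> j < N \<Longrightarrow> i \<noteq> j \<Longrightarrow> B i \<inter> B j = {}"
    and C: "\<And>J. J \<subseteq> {..<N} \<Longrightarrow> C J \<in> sets \<mu>"
      "\<And>J i. J \<subseteq> {..<N} \<Longrightarrow> i \<in> J \<Longrightarrow> B i \<subseteq> C J"
      "\<And>J i. J \<subseteq> {..<N} \<Longrightarrow> i < N \<Longrightarrow> i \<notin> J \<Longrightarrow> C J \<inter> B i = {}"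
    and L: "\<And>s. L s \<in> sets \<mu>"
    and \<sigma>: "\<And>k. k < m \<Longrightarrow> \<sigma> k \<in> (\<Union>i<N. B i)"
  shows "2 ^ N / 4 \<le> (\<Sum>J\<in>Pow {..<N}. err L \<mu> (C J) m \<sigma>)"
proof -
  interpret prob_space \<mu> by fact
  have "\<forall>k. \<exists>i. k < m \<longrightarrow> i < N \<and> \<sigma> k \<in> B i" using \<sigma> by blast
  then obtain \<kappa> where \<kappa>: "\<And>k. k < m \<Longrightarrow> \<kappa> k < N" "\<And>k. k < m \<Longrightarrow> \<sigma> k \<in> B (\<kappa> k)" by metis
  define unseen where "unseen = {..<N} - \<kappa> ` {..<m}"
  define D where "D J = sym_diff (L (labelled m \<sigma> (C J))) (C J)" for J
  have "card (\<kappa> ` {..<m}) \<le> m" using card_image_le[of "{..<m}" \<kappa>] by simp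
  then have "N - m \<le> card unseen"
    unfolding unseen_def using diff_card_le_card_Diff[of "\<kappa> ` {..<m}" "{..<N}"] by simp
  then have card: "real N / 2 \<le> card unseen" using N by linarith
  have Dm: "D J \<in> sets \<mu>" if "J \<subseteq> {..<N}" for J unfolding D_def using L C(1)[OF that] by blast
  have mem: "\<sigma> k \<in> C J \<longleftrightarrow> \<kappa> k \<in> J" if "J \<subseteq> {..<N}" "k < m" for J k
    using C(2)[OF that(1), of "\<kappa> k"] C(3)[OF that(1), of "\<kappa> k"] \<kappa>[OF that(2)] by blast
  have half: "(\<Sum>J\<in>Pow {..<N}. measure \<mu> (D J \<inter> B j)) = 2 ^ (N - 1) * (1 / N)" if j: "j \<in> unseen" for j
  proof -
    have jN: "j < N" and jk: "\<And>k. k < m \<Longrightarrow> \<kappa> k \<noteq> j" using j by (auto simp: unseen_def)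
    have "measure \<mu> (D J \<inter> B j) + measure \<mu> (D (insert j J) \<inter> B j) = 1 / N"
      if J: "J \<subseteq> {..<N} - {j}" for J
    proof -
      have J1: "J \<subseteq> {..<N}" and J2: "insert j J \<subseteq> {..<N}" and jJ: "j \<notin> J" using J jN by auto
      have "labelled m \<sigma> (C (insert j J)) = labelled m \<sigma> (C J)"
        unfolding labelled_def using mem[OF J1] mem[OF J2] jk by auto
      then obtain E where E: "L (labelled m \<sigma> (C J)) = E" "L (labelled m \<sigma> (C (insert j J))) = E"
        by simp
      have "D J \<inter> B j = B j \<inter> E" using C(3)[OF J1 jN jJ] unfolding D_def E by blast
      moreover have "D (insert j J) \<inter> B j = B j - E"
        using C(2)[OF J2, of j] unfolding D_def E by blast
      moreover have "E \<in> sets \<mu>" using E(1) L by blast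
      ultimately show ?thesis using finite_measure_Diff'[OF B(1)[OF jN], of E] B(2)[OF jN] by simp
    qed
    then show ?thesis using sum_Pow_pair[of "{..<N}" j "\<lambda>J. measure \<mu> (D J \<inter> B j)"] jN by simp
  qed
  have le: "(\<Sum>j\<in>unseen. measure \<mu> (D J \<inter> B j)) \<le> err L \<mu> (C J) m \<sigma>" if J: "J \<subseteq> {..<N}" for J
  proof -
    have "(\<Sum>j\<in>unseen. measure \<mu> (D J \<inter> B j)) = measure \<mu> (\<Union>j\<in>unseen. D J \<inter> B j)"
    proof (rule finite_measure_finite_Union[symmetric])
      show "(\<lambda>j. D J \<inter> B j) ` unseen \<subseteq> sets \<mu>" using Dm[OF J] B(1) by (auto simp: unseen_def)
      show "disjoint_family_on (\<lambda>j. D J \<inter> B j) unseen"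
        using disj by (force simp: disjoint_family_on_def unseen_def)
    qed (simp add: unseen_def)
    also have "\<dots> \<le> measure \<mu> (D J)" by (rule finite_measure_mono[OF _ Dm[OF J]]) blast
    finally show ?thesis by (simp add: err_def D_def)
  qed
  \<comment> \<open>At least N/2 unseen blocks, each contributing 1/N for every one of the
    \<open>2 ^ (N - 1)\<close> pairs.\<close>
  have "(2::real) ^ N / 4 = real N / 2 * (2 ^ (N - 1) * (1 / N))"
    using N(1) by (cases N) (simp_all add: field_simps del: of_nat_Suc)
  also have "\<dots> \<le> card unseen * (2 ^ (N - 1) * (1 / N))"
    using card by (intro mult_right_mono) auto
  also have "\<dots> = (\<Sum>j\<in>unseen. \<Sum>J\<in>Pow {..<N}. measure \<mu> (D J \<inter> B j))" using half by simp
  also have "\<dots> = (\<Sum>J\<in>Pow {..<N}. \<Sum>j\<in>unseen. measure \<mu> (D J \<inter> B j))" by (rule sum.swap)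
  also have "\<dots> \<le> (\<Sum>J\<in>Pow {..<N}. err L \<mu> (C J) m \<sigma>)" using le by (intro sum_mono) auto
  finally show ?thesis .
qed

section \<open>From shattering to the failure of learnability\<close>

text \<open>The shattered sets may be arbitrary, while the perfect set theorem needs Borel sets.
  Replacing each by the atom containing it is harmless: a finite intersection of concepts and
  complements is Borel, and a superset of an uncountable set is uncountable.\<close>

lemma shatters_mod_omega1_borel:
  assumes "shatters_mod_omega1 (space M) \<C> N" "\<C> \<subseteq> sets M"
  shows "\<exists>(B :: nat \<Rightarrow> 'a set) C. (\<forall>i<N. B i \<in> sets M \<and> uncountable (B i)) \<and>
    (\<forall>i<N. \<forall>j<N. i \<noteq> j \<longrightarrow> B i \<inter> B j = {}) \<and>
    (\<forall>J\<subseteq>{..<N}. C J \<in> \<C> \<and> (\<forall>i\<in>J. B i \<subseteq> C J) \<and> (\<forall>i\<in>{..<N} - J. C J \<inter> B i = {}))"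
proof -
  obtain A where A: "\<forall>i<N. A i \<subseteq> space M \<and> uncountable (A i)"
    and shattered: "\<forall>J\<subseteq>{..<N}. \<exists>C\<in>\<C>. (\<forall>i\<in>J. A i \<subseteq> C) \<and> (\<forall>j\<in>{..<N} - J. C \<inter> A j = {})"
    using assms(1) unfolding shatters_mod_omega1_def by (elim exE conjE)
  have "\<forall>J. \<exists>C. J \<subseteq> {..<N} \<longrightarrow> C \<in> \<C> \<and> (\<forall>i\<in>J. A i \<subseteq> C) \<and> (\<forall>j\<in>{..<N} - J. C \<inter> A j = {})"
    using shattered by (simp add: Bex_def)
  then obtain C where "\<forall>J. J \<subseteq> {..<N} \<longrightarrow>
      C J \<in> \<C> \<and> (\<forall>i\<in>J. A i \<subseteq> C J) \<and> (\<forall>j\<in>{..<N} - J. C J \<inter> A j = {})"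
    unfolding choice_iff by (elim exE)
  then have C: "\<And>J. J \<subseteq> {..<N} \<Longrightarrow> C J \<in> \<C>"
    "\<And>J i. J \<subseteq> {..<N} \<Longrightarrow> i \<in> J \<Longrightarrow> A i \<subseteq> C J"
    "\<And>J j. J \<subseteq> {..<N} \<Longrightarrow> j \<in> {..<N} - J \<Longrightarrow> C J \<inter> A j = {}"
    by simp_all
  define B where "B i = (\<Inter>J\<in>Pow {..<N}. if i \<in> J then C J else space M - C J)" for i
  have B1: "B i \<subseteq> C J" if "J \<subseteq> {..<N}" "i \<in> J" for i J
  proof -
    have "B i \<subseteq> (if i \<in> J then C J else space M - C J)"
      unfolding B_def using that(1) by (intro INT_lower) simp
    with that(2) show ?thesis by simp
  qed
  have B2: "C J \<inter> B i = {}" if "J \<subseteq> {..<N}" "i \<notin> J" for i J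
  proof -
    have "B i \<subseteq> (if i \<in> J then C J else space M - C J)"
      unfolding B_def using that(1) by (intro INT_lower) simp
    with that(2) show ?thesis by auto
  qed
  have "B i \<in> sets M" "uncountable (B i)" if i: "i < N" for i
  proof -
    have "(if i \<in> J then C J else space M - C J) \<in> sets M" if "J \<in> Pow {..<N}" for J
      using that C(1)[of J] assms(2) by auto
    then show "B i \<in> sets M" unfolding B_def by (intro sets.finite_INT) auto
    have "A i \<subseteq> (if i \<in> J then C J else space M - C J)" if "J \<in> Pow {..<N}" for J
      using that C(2)[of J i] C(3)[of J i] A i by auto
    then have "A i \<subseteq> B i" unfolding B_def by (intro INT_greatest)
    then show "uncountable (B i)" using A i countable_subset by blast
  qed
  \<comment> \<open>The concept of the singleton \<open>{i}\<close> contains \<open>B i\<close> and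
    misses \<open>B j\<close>.\<close>
  moreover have "B i \<inter> B j = {}" if "i < N" "j < N" "i \<noteq> j" for i j
    using that B1[of "{i}" i] B2[of "{i}" j] by auto
  ultimately show ?thesis using C(1) B1 B2 by (intro exI[of _ B] exI[of _ C]) simp
qed

text \<open>The probabilistic method: almost every sample is bad for at least an eighth of the
  \<open>2 ^ N\<close> concepts, so integrating the number of bad concepts shows that some concept
  is bad with probability at least 1/8.\<close>

lemma exists_concept_with_large_error:
  fixes B :: "nat \<Rightarrow> 'a set" and C :: "nat set \<Rightarrow> 'a set"
  assumes \<mu>: "prob_space \<mu>" and N: "N > 0" "2 * m \<le> N"
    and B: "\<And>i. i < N \<Longrightarrow> B i \<in> sets \<mu>" "\<And>i. i < N \<Longrightarrow> measure \<mu> (B i) = 1 / N"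
    and disj: "\<And>i j. i < N \<Longrightarrow> j < N \<Longrightarrow> i \<noteq> j \<Longrightarrow> B i \<inter> B j = {}"
    and C: "\<And>J. J \<subseteq> {..<N} \<Longrightarrow> C J \<in> sets \<mu>"
      "\<And>J i. J \<subseteq> {..<N} \<Longrightarrow> i \<in> J \<Longrightarrow> B i \<subseteq> C J"
      "\<And>J i. J \<subseteq> {..<N} \<Longrightarrow> i < N \<Longrightarrow> i \<notin> J \<Longrightarrow> C J \<inter> B i = {}"
    and L: "\<And>s. L s \<in> sets \<mu>"
      "\<And>J. J \<subseteq> {..<N} \<Longrightarrow> err L \<mu> (C J) m \<in> borel_measurable (completion (prodn m \<mu>))"
  shows "\<exists>J\<subseteq>{..<N}. ennreal (1 / 8) \<le>
    emeasure (completion (prodn m \<mu>)) {\<sigma> \<in> space (prodn m \<mu>). err L \<mu> (C J) m \<sigma> > 1 / 8}"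
proof (rule ccontr)
  interpret prob_space \<mu> by fact
  \<comment> \<open>The error is assumed measurable only for the completed product.\<close>
  define Q where "Q = completion (prodn m \<mu>)"
  define bad where "bad J = {\<sigma> \<in> space Q. err L \<mu> (C J) m \<sigma> > 1 / 8}" for J
  assume "\<not> ?thesis"
  then have small: "emeasure Q (bad J) < ennreal (1 / 8)" if "J \<subseteq> {..<N}" for J
    using that by (auto simp: Q_def bad_def not_le)
  have badm: "bad J \<in> sets Q" if "J \<subseteq> {..<N}" for J
  proof -
    have [measurable]: "err L \<mu> (C J) m \<in> borel_measurable Q" using L(2)[OF that] by (simp add: Q_def)
    show ?thesis unfolding bad_def by measurable
  qed
  have prQ: "prob_space (prodn m \<mu>)" unfolding prodn_def by (intro prob_space_PiM \<mu>)
  then interpret Q: prob_space Q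
    by (intro prob_spaceI) (simp add: Q_def prob_space.emeasure_space_1)
  have "measure \<mu> (\<Union>i<N. B i) = (\<Sum>i<N. measure \<mu> (B i))"
    using B(1) disj by (intro finite_measure_finite_Union) (auto simp: disjoint_family_on_def)
  then have "prob (\<Union>i<N. B i) = 1" using B(2) N by simp
  then have "AE x in \<mu>. x \<in> (\<Union>i<N. B i)" using B(1) by (subst prob_eq_1[symmetric]) auto
  then have "AE \<sigma> in prodn m \<mu>. \<forall>k\<in>{..<m}. \<sigma> k \<in> (\<Union>i<N. B i)"
    unfolding prodn_def by (intro AE_finite_allI AE_PiM_component \<mu>) auto
  then have "AE \<sigma> in Q. \<forall>k\<in>{..<m}. \<sigma> k \<in> (\<Union>i<N. B i)" unfolding Q_def by (rule AE_completion)
  then have "AE \<sigma> in Q. ennreal (2 ^ N / 8) \<le> (\<Sum>J\<in>Pow {..<N}. indicator (bad J) \<sigma>)"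
  proof (rule AE_mp, intro AE_I2 impI)
    fix \<sigma> assume \<sigma>: "\<sigma> \<in> space Q" "\<forall>k\<in>{..<m}. \<sigma> k \<in> (\<Union>i<N. B i)"
    \<comment> \<open>An error is at most 1, and at most 1/8 off the bad set; of the average 1/4, at
      least 1/8 therefore comes from bad concepts.\<close>
    have "err L \<mu> (C J) m \<sigma> \<le> indicator (bad J) \<sigma> + 1 / 8" for J
    proof -
      have "err L \<mu> (C J) m \<sigma> \<le> 1" by (simp add: err_def)
      then show ?thesis using \<sigma>(1) by (simp add: bad_def indicator_def)
    qed
    then have "(\<Sum>J\<in>Pow {..<N}. err L \<mu> (C J) m \<sigma>) \<le> (\<Sum>J\<in>Pow {..<N}. indicator (bad J) \<sigma> + 1 / 8)"
      by (intro sum_mono)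
    moreover have "2 ^ N / 4 \<le> (\<Sum>J\<in>Pow {..<N}. err L \<mu> (C J) m \<sigma>)"
      using \<sigma>(2) by (intro sum_err_lower_bound[OF \<mu> N B disj C L(1)]) auto
    ultimately have "2 ^ N / 8 \<le> (\<Sum>J\<in>Pow {..<N}. indicator (bad J) \<sigma> :: real)"
      by (simp add: sum.distrib card_Pow)
    then have "ennreal (2 ^ N / 8) \<le> ennreal (\<Sum>J\<in>Pow {..<N}. indicator (bad J) \<sigma>)"
      by (rule ennreal_leI)
    then show "ennreal (2 ^ N / 8) \<le> (\<Sum>J\<in>Pow {..<N}. indicator (bad J) \<sigma>)"
      by (simp add: sum_ennreal[symmetric] ennreal_indicator)
  qed
  then have "(\<integral>\<^sup>+\<sigma>. ennreal (2 ^ N / 8) \<partial>Q) \<le> (\<integral>\<^sup>+\<sigma>. (\<Sum>J\<in>Pow {..<N}. indicator (bad J) \<sigma>) \<partial>Q)"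
    by (rule nn_integral_mono_AE)
  also have "\<dots> = (\<Sum>J\<in>Pow {..<N}. emeasure Q (bad J))"
    using badm by (subst nn_integral_sum) auto
  also have "\<dots> = ennreal (\<Sum>J\<in>Pow {..<N}. measure Q (bad J))"
    by (simp add: Q.emeasure_eq_measure)
  finally have "2 ^ N / 8 \<le> (\<Sum>J\<in>Pow {..<N}. measure Q (bad J))"
    by (simp add: Q.emeasure_space_1 sum_nonneg)
  also have "\<dots> < (\<Sum>J\<in>Pow {..<N}. 1 / 8)"
    using small by (intro sum_strict_mono) (auto simp: Q.emeasure_eq_measure ennreal_less_iff)
  also have "\<dots> = 2 ^ N / 8" by (simp add: card_Pow)
  finally show False by simp
qed

lemma VC_mod_omega1_infinite:
  assumes "\<not> VC_mod_omega1 \<Omega> \<C> < \<infinity>"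
  shows "\<exists>N\<ge>m. shatters_mod_omega1 \<Omega> \<C> N"
proof -
  have "enat m < Sup {enat n | n. shatters_mod_omega1 \<Omega> \<C> n}"
    using assms by (simp add: VC_mod_omega1_def)
  then obtain n where "m < n" "shatters_mod_omega1 \<Omega> \<C> n" by (auto simp: less_Sup_iff)
  then show ?thesis by (intro exI[of _ n]) simp
qed

theorem mainTheorem11:
  fixes M :: "'a measure" and \<C> :: "'a set set"
  assumes "standard_borel M"
    and "\<C> \<subseteq> sets M"
    and "PAC_learnable \<C> (nonatomic_probs M)"
  shows "VC_mod_omega1 (space M) \<C> < \<infinity>"
proof (rule ccontr)
  let ?P = "nonatomic_probs M"
  obtain L where L: "learning_rule \<C> ?P L" and
    lim: "(\<lambda>m. SUP \<mu>\<in>?P. SUP C\<in>\<C>. emeasure (completion (prodn m \<mu>))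
      {\<sigma> \<in> space (prodn m \<mu>). err L \<mu> C m \<sigma> > 1 / 8}) \<longlonglongrightarrow> 0"
    using assms(3) unfolding PAC_learnable_def PAC_rule_def by (meson zero_less_divide_1_iff zero_less_numeral)
  \<comment> \<open>The sample size is fixed before \<open>N\<close> and the measure are chosen;
    this is where uniformity over all non-atomic measures enters.\<close>
  obtain m where m: "(SUP \<mu>\<in>?P. SUP C\<in>\<C>. emeasure (completion (prodn m \<mu>))
      {\<sigma> \<in> space (prodn m \<mu>). err L \<mu> C m \<sigma> > 1 / 8}) < ennreal (1 / 8)"
    using order_tendstoD(2)[OF lim, of "ennreal (1 / 8)"] by (auto simp: eventually_sequentially)
  assume "\<not> VC_mod_omega1 (space M) \<C> < \<infinity>"
  \<comment> \<open>The extra 1 keeps \<open>N\<close> positive when \<open>m = 0\<close>.\<close>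
  then obtain N where N: "2 * m + 1 \<le> N" "shatters_mod_omega1 (space M) \<C> N"
    using VC_mod_omega1_infinite by blast
  then have N': "N > 0" "2 * m \<le> N" by auto
  obtain B :: "nat \<Rightarrow> 'a set" and C :: "nat set \<Rightarrow> 'a set" where
    blocks: "\<forall>i<N. B i \<in> sets M \<and> uncountable (B i)" "\<forall>i<N. \<forall>j<N. i \<noteq> j \<longrightarrow> B i \<inter> B j = {}"
      "\<forall>J\<subseteq>{..<N}. C J \<in> \<C> \<and> (\<forall>i\<in>J. B i \<subseteq> C J) \<and> (\<forall>i\<in>{..<N} - J. C J \<inter> B i = {})"
    using shatters_mod_omega1_borel[OF N(2) assms(2)] by (elim exE conjE)
  have B: "\<And>i. i < N \<Longrightarrow> B i \<in> sets M" "\<And>i. i < N \<Longrightarrow> uncountable (B i)"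
    and disj: "\<And>i j. i < N \<Longrightarrow> j < N \<Longrightarrow> i \<noteq> j \<Longrightarrow> B i \<inter> B j = {}"
    and C: "\<And>J. J \<subseteq> {..<N} \<Longrightarrow> C J \<in> \<C>"
      "\<And>J i. J \<subseteq> {..<N} \<Longrightarrow> i \<in> J \<Longrightarrow> B i \<subseteq> C J"
      "\<And>J i. J \<subseteq> {..<N} \<Longrightarrow> i < N \<Longrightarrow> i \<notin> J \<Longrightarrow> C J \<inter> B i = {}"
    using blocks by simp_all
  obtain \<mu> where \<mu>: "\<mu> \<in> ?P" "\<And>i. i < N \<Longrightarrow> measure \<mu> (B i) = 1 / N"
    using exists_nonatomic_prob_on_blocks[OF assms(1) N'(1), of B] B disj by blast
  have pr: "prob_space \<mu>" and sets: "sets \<mu> = sets M" using \<mu>(1) by (auto simp: nonatomic_probs_def)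
  have "\<exists>J\<subseteq>{..<N}. ennreal (1 / 8) \<le>
    emeasure (completion (prodn m \<mu>)) {\<sigma> \<in> space (prodn m \<mu>). err L \<mu> (C J) m \<sigma> > 1 / 8}"
  proof (rule exists_concept_with_large_error[where B = B, OF pr N' _ \<mu>(2) disj _ C(2,3)])
    show "L s \<in> sets \<mu>" for s using L assms(2) sets by (auto simp: learning_rule_def)
    show "err L \<mu> (C J) m \<in> borel_measurable (completion (prodn m \<mu>))" if "J \<subseteq> {..<N}" for J
      using L C(1)[OF that] \<mu>(1) by (auto simp: learning_rule_def)
  qed (use B(1) C(1) assms(2) sets in auto)
  then obtain J where J: "J \<subseteq> {..<N}" "ennreal (1 / 8) \<le>
    emeasure (completion (prodn m \<mu>)) {\<sigma> \<in> space (prodn m \<mu>). err L \<mu> (C J) m \<sigma> > 1 / 8}"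
    by blast
  note J(2)
  also have "\<dots> \<le> (SUP C\<in>\<C>. emeasure (completion (prodn m \<mu>))
      {\<sigma> \<in> space (prodn m \<mu>). err L \<mu> C m \<sigma> > 1 / 8})"
    using C(1)[OF J(1)] by (rule SUP_upper)
  also have "\<dots> \<le> (SUP \<mu>\<in>?P. SUP C\<in>\<C>. emeasure (completion (prodn m \<mu>))
      {\<sigma> \<in> space (prodn m \<mu>). err L \<mu> C m \<sigma> > 1 / 8})"
    using \<mu>(1) by (rule SUP_upper)
  also note m
  finally show False by simp
qed

end
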